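(* Let $d\in\mathbb{Z}_+$, $t\ge15$ and $\xi\in\mathbb{T}^d$. Then $$\mathcal{F}_{\mathbb{Z}^d}g_t(\xi)\le\exp\big(-\pi t|\xi|^2/10\big).$$
   Context: $\mathbb{Z}_+=\{1,2,\dots\}$. The torus $\mathbb{T}^d=\mathbb{R}^d/\mathbb{Z}^d$ is identified with $[-1/2,1/2)^d$, and $|\xi|$ is the Euclidean norm of the representative in $[-1/2,1/2)^d$. For $t>0$, $g_t:\mathbb{Z}^d\to\mathbb{R}$ is the discrete normalized Gaussian $$g_t(n)=\frac{\exp(-\pi|n|^2/t)}{\sum_{k\in\mathbb{Z}^d}\exp(-\pi|k|^2/t)},$$ and for $f\in\ell^1(\mathbb{Z}^d)$, $\mathcal{F}_{\mathbb{Z}^d}f(\xi)=\sum_{n\in\mathbb{Z}^d}f(n)e^{2\pi i n\cdot\xi}$. (The function $\mathcal{F}_{\mathbb{Z}^d}g_t$ is real-valued by symmetry.) *)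

theory Defs
  imports "HOL-Analysis.Analysis"
begin

text \<open>
  The lattice of integer points in dimension d is the type \<open>int ^ 'n\<close>, where
  d = \<open>CARD('n)\<close>; as \<open>'n :: finite\<close> is nonempty, d ranges over the positive integers.
\<close>

definition real_vec :: "int ^ 'n \<Rightarrow> real ^ 'n" where
  "real_vec n = (\<chi> i. real_of_int (n $ i))"

text \<open>
  The torus is represented by its fundamental domain; the size of a point of the torus
  is the Euclidean norm of its representative in this set.
\<close>

definition torus :: "(real ^ 'n) set" where
  "torus = {\<xi>. \<forall>i. -1/2 \<le> \<xi> $ i \<and> \<xi> $ i < 1/2}"

definition discrete_gaussian :: "real \<Rightarrow> int ^ 'n \<Rightarrow> real" where
  "discrete_gaussian t n =
     exp (- pi * (norm (real_vec n))\<^sup>2 / t) /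
     (\<Sum>\<^sub>\<infinity>k::int ^ 'n. exp (- pi * (norm (real_vec k))\<^sup>2 / t))"

text \<open>
  The sum below is meant for absolutely summable \<open>f\<close> only (otherwise \<open>infsum\<close> may
  return 0).
\<close>

definition fourier_lattice :: "(int ^ 'n \<Rightarrow> complex) \<Rightarrow> real ^ 'n \<Rightarrow> complex" where
  "fourier_lattice f \<xi> =
     (\<Sum>\<^sub>\<infinity>n. f n * exp (2 * of_real pi * \<i> * of_real (real_vec n \<bullet> \<xi>)))"

end

theory Submission
  imports Defs
begin

text \<open>
  Both the Gaussian and the characters factor over the coordinates, so the Fourier transform of
  the discrete Gaussian is a product of one-dimensional quotients
  \<open>theta q (cis (2 pi \<xi>\<^sub>i)) / theta q 1\<close> with \<open>q = exp (- pi / t)\<close> and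
  \<open>theta q z = (\<Sum>k. q ^ k\<^sup>2 z ^ k)\<close> (\<open>fourier_discrete_gaussian\<close>). As the exponential of
  \<open>- pi t \<bar>\<xi>\<bar>\<^sup>2 / 10\<close> factors in the same way, it suffices to show that each quotient is a real
  number between 0 and \<open>exp (- pi t \<xi>\<^sub>i\<^sup>2 / 10)\<close>; nonnegativity is needed to multiply the bounds.

  The one-dimensional bound rests on Jacobi's triple product. It writes \<open>theta q z\<close>, up to a
  factor that does not depend on \<open>z\<close>, as the product over odd \<open>m > 0\<close> of
  \<open>(1 + z q ^ m) (1 + q ^ m / z)\<close>, so that the quotient becomes
  \<open>\<Prod>m odd. 1 - 2 q ^ m (1 - cos (2 pi x)) / (1 + q ^ m)\<^sup>2\<close> (\<open>theta_quotient_product\<close>).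
  All factors lie in \<open>[0, 1]\<close>. About \<open>t / (2 pi)\<close> of them have \<open>m \<le> t / pi\<close>, and each of these
  is at most \<open>exp (- 3 x\<^sup>2)\<close> since \<open>1 - cos (2 pi x) \<ge> 8 x\<^sup>2\<close>; these factors alone give the claim
  (\<open>theta_quotient_bound\<close>).

  The triple product is obtained from its finite version (\<open>finite_triple_product\<close>), an identity
  between Laurent polynomials whose coefficients are \<open>q ^ k\<^sup>2\<close> times Gaussian binomial
  coefficients. Up to normalization these coefficients are bounded and tend to \<open>q ^ k\<^sup>2\<close>, and
  dominated convergence gives the theta function (\<open>theta_tendsto\<close>).
\<close>

section \<open>Reciprocal q-Pochhammer symbols\<close>

text \<open>
  For \<open>m \<ge> 0\<close> this is \<open>1 / (p; p)\<^sub>m\<close>. The value 0 at negative \<open>m\<close> makes the recursion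
  \<open>(p; p)\<^sub>m = (1 - p ^ m) (p; p)\<^sub>m\<^sub>-\<^sub>1\<close>, read for reciprocals, true at every integer: at
  \<open>m = 0\<close> the factor \<open>1 - p ^ 0\<close> vanishes. Coefficients of the finite triple product are
  products of two such values, so their support and its boundary need no case distinctions.
\<close>

definition inv_qpoch :: "real \<Rightarrow> int \<Rightarrow> real" where
  "inv_qpoch p m = (if m < 0 then 0 else 1 / (\<Prod>j<nat m. 1 - p ^ Suc j))"

lemma inv_qpoch_diff_1:
  assumes "0 < p" "p < 1"
  shows "inv_qpoch p (m - 1) = (1 - p powi m) * inv_qpoch p m"
proof (cases "m \<le> 0")
  case True
  then show ?thesis by (cases "m = 0") (auto simp: inv_qpoch_def)
next
  case False
  then obtain n where m: "m = int (Suc n)"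
    by (metis not_le zero_less_imp_eq_int gr0_implies_Suc)
  have "p ^ Suc n < 1"
    using assms by (simp add: power_less_one_iff del: power_Suc)
  then have "1 - p ^ Suc n \<noteq> 0" by simp
  moreover have "p powi m = p ^ Suc n" unfolding m by (rule power_int_of_nat)
  moreover have "nat m = Suc n" "nat (m - 1) = n" "m \<ge> 0" "m - 1 \<ge> 0" using m by auto
  ultimately show ?thesis by (simp add: inv_qpoch_def del: power_Suc)
qed

lemma inv_qpoch_0 [simp]: "inv_qpoch p 0 = 1"
  by (simp add: inv_qpoch_def)

lemma inv_qpoch_neg [simp]: "m < 0 \<Longrightarrow> inv_qpoch p m = 0"
  by (simp add: inv_qpoch_def)

text \<open>
  The Euler product \<open>\<Prod>j\<ge>1. 1 - p ^ j\<close> converges absolutely and has no zero factor, so its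
  value is nonzero.
\<close>

lemma inv_qpoch_tendsto:
  assumes "0 < p" "p < 1"
  obtains L where "L > 0" "(\<lambda>n. inv_qpoch p (int n)) \<longlonglongrightarrow> L"
proof -
  define f where "f = (\<lambda>j. 1 - p ^ Suc j)"
  have pos: "f j > 0" for j
    using assms by (simp add: f_def power_less_one_iff del: power_Suc)
  have "summable (\<lambda>j. p ^ Suc j)"
    using assms by (intro summable_geometric[THEN summable_Suc_iff[THEN iffD2]]) auto
  then have "abs_convergent_prod f"
    using assms by (intro summable_imp_abs_convergent_prod) (simp add: f_def)
  then have conv: "convergent_prod f" by (rule abs_convergent_prod_imp_convergent_prod)
  have nz: "prodinf f \<noteq> 0"
    using pos by (intro prodinf_nonzero[OF conv]) (metis less_irrefl)
  have lim: "(\<lambda>n. \<Prod>j<n. f j) \<longlonglongrightarrow> prodinf f"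
    using convergent_prod_LIMSEQ[OF conv]
    by (subst filterlim_sequentially_Suc[symmetric]) (simp add: lessThan_Suc_atMost)
  have "prodinf f \<ge> 0"
    by (rule LIMSEQ_le_const[OF lim]) (auto intro!: prod_nonneg less_imp_le[OF pos])
  with nz have "1 / prodinf f > 0" by simp
  moreover have "(\<lambda>n. inv_qpoch p (int n)) \<longlonglongrightarrow> 1 / prodinf f"
    using tendsto_divide[OF tendsto_const lim nz, of 1] by (simp add: inv_qpoch_def f_def)
  ultimately show thesis by (rule that)
qed

section \<open>The finite Jacobi triple product\<close>

text \<open>
  With \<open>p = q\<^sup>2\<close>, this is the Gaussian binomial coefficient \<open>[2N choose N + k]\<close> in base \<open>p\<close>,
  divided by \<open>(p; p)\<^sub>2\<^sub>N\<close>.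
\<close>

definition triple_coeff :: "real \<Rightarrow> nat \<Rightarrow> int \<Rightarrow> real" where
  "triple_coeff q N k = inv_qpoch (q\<^sup>2) (int N + k) * inv_qpoch (q\<^sup>2) (int N - k)"

text \<open>
  Multiplying a Laurent polynomial in \<open>z\<close> by \<open>(1 + a z) (1 + a / z) = 1 + a\<^sup>2 + a (z + 1 / z)\<close>
  mixes each coefficient with its two neighbours; the identity says that the coefficients
  \<open>w N\<close> turn into multiples of \<open>w (Suc N)\<close> when \<open>a = q ^ (2 * N + 1)\<close>. By the recursion of
  \<open>inv_qpoch\<close> all three values of \<open>w N\<close> are explicit multiples of \<open>w (Suc N) k\<close>, after which
  only an identity between rational functions of \<open>a\<close>, \<open>q\<close> and \<open>y = q ^ (2 * k)\<close> remains.
\<close>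

lemma triple_coeff_Suc:
  fixes q :: real
  assumes q: "0 < q" "q < 1"
  defines "w \<equiv> \<lambda>N k. triple_coeff q N k * q powi (k\<^sup>2)"
  shows "(1 - (q\<^sup>2) powi (2 * int N + 1)) * (1 - (q\<^sup>2) powi (2 * int N + 2)) * w (Suc N) k =
         (1 + q ^ (2*N+1) * q ^ (2*N+1)) * w N k + q ^ (2*N+1) * (w N (k-1) + w N (k+1))"
proof -
  define a where "a = q ^ (2*N+1)"
  define y where "y = q powi (2*k)"
  define p where "p = q\<^sup>2"
  define A where "A = inv_qpoch p (int N + 1 + k)"
  define B where "B = inv_qpoch p (int N + 1 - k)"
  have p: "0 < p" "p < 1" using q by (auto simp: p_def power_less_one_iff)
  have y: "y > 0" using q by (simp add: y_def)
  have pp: "p powi m = q powi (2*m)" for m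
    unfolding p_def by (simp add: power_int_power)
  have a': "a = q powi (2 * int N + 1)"
    unfolding a_def by (subst power_int_of_nat[symmetric]) (simp add: add.commute)
  have q0: "q \<noteq> 0" using q by simp
  note powi_ring = power_int_add[OF disjI1[OF q0]] power_int_diff[OF disjI1[OF q0]]
    power_int_1_right power_int_numeral times_divide_eq_right times_divide_eq_left mult.assoc
  have e1: "p powi (int N + 1 + k) = a * q * y"
  proof -
    have "q powi (2 * (int N + 1 + k)) = q powi ((2 * int N + 1) + 1 + 2 * k)"
      by (rule arg_cong) simp
    then show ?thesis unfolding pp a' y_def by (simp only: powi_ring)
  qed
  have e2: "p powi (int N + k) = a * y / q"
  proof -
    have "q powi (2 * (int N + k)) = q powi ((2 * int N + 1) + 2 * k - 1)"
      by (rule arg_cong) simp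
    then show ?thesis unfolding pp a' y_def by (simp only: powi_ring)
  qed
  have e3: "p powi (int N + 1 - k) = a * q / y"
  proof -
    have "q powi (2 * (int N + 1 - k)) = q powi ((2 * int N + 1) + 1 - 2 * k)"
      by (rule arg_cong) simp
    then show ?thesis unfolding pp a' y_def by (simp only: powi_ring)
  qed
  have e4: "p powi (int N - k) = a / (q * y)"
  proof -
    have "q powi (2 * (int N - k)) = q powi ((2 * int N + 1) - (1 + 2 * k))"
      by (rule arg_cong) simp
    then show ?thesis unfolding pp a' y_def by (simp only: powi_ring)
  qed
  have e5: "p powi (2 * int N + 1) = a * a"
  proof -
    have "q powi (2 * (2 * int N + 1)) = q powi ((2 * int N + 1) + (2 * int N + 1))"
      by (rule arg_cong) simp
    then show ?thesis unfolding pp a' by (simp only: powi_ring)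
  qed
  have e6: "p powi (2 * int N + 2) = a * a * q\<^sup>2"
  proof -
    have "q powi (2 * (2 * int N + 2)) = q powi ((2 * int N + 1) + (2 * int N + 1) + 2)"
      by (rule arg_cong) simp
    then show ?thesis unfolding pp a' by (simp only: powi_ring)
  qed
  define Q where "Q = q powi (k\<^sup>2)"
  have Q1: "q powi ((k - 1)\<^sup>2) = Q * q / y"
  proof -
    have "q powi ((k - 1)\<^sup>2) = q powi (k\<^sup>2 + 1 - 2 * k)"
      by (rule arg_cong) (simp add: power2_eq_square algebra_simps)
    then show ?thesis unfolding Q_def y_def by (simp only: powi_ring)
  qed
  have Q2: "q powi ((k + 1)\<^sup>2) = Q * q * y"
  proof -
    have "q powi ((k + 1)\<^sup>2) = q powi (k\<^sup>2 + 1 + 2 * k)"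
      by (rule arg_cong) (simp add: power2_eq_square algebra_simps)
    then show ?thesis unfolding Q_def y_def by (simp only: powi_ring)
  qed
  note rec = inv_qpoch_diff_1[OF p]
  have A1: "inv_qpoch p (int N + k) = (1 - a * q * y) * A"
    using rec[of "int N + 1 + k"] unfolding e1 A_def by simp
  have A2: "inv_qpoch p (int N + (k - 1)) = (1 - a * y / q) * ((1 - a * q * y) * A)"
    by (simp only: add_diff_eq rec e2 A1)
  have B1: "inv_qpoch p (int N - k) = (1 - a * q / y) * B"
  proof -
    have "int N - k = int N + 1 - k - 1" by simp
    then show ?thesis by (simp only: rec e3 B_def)
  qed
  have B2: "inv_qpoch p (int N - (k + 1)) = (1 - a / (q * y)) * ((1 - a * q / y) * B)"
    by (simp only: diff_diff_eq[symmetric] rec e4 B1)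
  have A0: "inv_qpoch p (int N + (k + 1)) = A" and B0: "inv_qpoch p (int N - (k - 1)) = B"
    and AB: "inv_qpoch p (int (Suc N) + k) = A" "inv_qpoch p (int (Suc N) - k) = B"
    by (simp_all add: A_def B_def algebra_simps)
  have w0: "w N k = (1 - a * q * y) * A * ((1 - a * q / y) * B) * Q"
    by (simp only: w_def triple_coeff_def p_def[symmetric] A1 B1 Q_def)
  have w1: "w N (k - 1) = (1 - a * y / q) * ((1 - a * q * y) * A) * B * (Q * q / y)"
    by (simp only: w_def triple_coeff_def p_def[symmetric] A2 B0 Q1)
  have w2: "w N (k + 1) = A * ((1 - a / (q * y)) * ((1 - a * q / y) * B)) * (Q * q * y)"
    by (simp only: w_def triple_coeff_def p_def[symmetric] A0 B2 Q2)
  have w3: "w (Suc N) k = A * B * Q"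
    by (simp only: w_def triple_coeff_def p_def[symmetric] AB Q_def)
  (* The recurrence after division by the common factor A * B * Q. *)
  have "(1 - a * a) * (1 - a * a * q\<^sup>2) =
        (1 + a * a) * (1 - a * q * y) * (1 - a * q / y) +
        a * ((1 - a * y / q) * (1 - a * q * y) * (q / y) + (1 - a / (q * y)) * (1 - a * q / y) * (q * y))"
    using q y by (simp add: field_simps power2_eq_square)
  note identity = this[folded p_def]
  have "(1 - p powi (2 * int N + 1)) * (1 - p powi (2 * int N + 2)) * w (Suc N) k =
        (1 - a * a) * (1 - a * a * p) * (A * B * Q)"
    unfolding w3 e5 e6 by (simp only: p_def)
  also have "\<dots> = (1 + a * a) * w N k + a * (w N (k-1) + w N (k+1))"
  proof -
    (* The quotients are kept opaque here so that they are only moved around, not expanded. *)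
    have regroup: "((1 + a * a) * U1 * U2 + a * (U3 * U1 * G1 + U4 * U2 * G2)) * (A * B * Q) =
        (1 + a * a) * (U1 * A * (U2 * B) * Q) + a * (U3 * (U1 * A) * B * (Q * G1) + A * (U4 * (U2 * B)) * (Q * G2))"
      for U1 U2 U3 U4 G1 G2 :: real
      by (simp add: algebra_simps)
    show ?thesis
      unfolding w0 w1 w2 identity regroup by simp
  qed
  finally show ?thesis by (simp only: p_def a_def)
qed

text \<open>
  The expansion of \<open>\<Prod>n<N. (1 + z q ^ (2n+1)) (1 + q ^ (2n+1) / z)\<close> in powers of \<open>z\<close>, by induction
  on \<open>N\<close>. The finitely many nonzero terms are summed over all integers, which turns
  multiplication by \<open>z\<close> or \<open>1 / z\<close> into a shift of the index without boundary terms.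
\<close>

lemma finite_triple_product:
  fixes q :: real and z :: complex
  assumes q: "0 < q" "q < 1" and z: "z \<noteq> 0"
  shows "((\<lambda>k. of_real (triple_coeff q N k * q powi (k\<^sup>2)) * z powi k) has_sum
           of_real (inv_qpoch (q\<^sup>2) (2 * int N)) *
           (\<Prod>n<N. (1 + z * of_real (q ^ (2*n+1))) * (1 + of_real (q ^ (2*n+1)) / z))) UNIV"
proof (induction N)
  case 0
  have "triple_coeff q 0 k = 0" if "k \<noteq> 0" for k
    using that by (cases "k < 0") (auto simp: triple_coeff_def)
  then show ?case
    by (intro has_sum_finite_neutralI[of "{0}"]) (auto simp: triple_coeff_def)
next
  case (Suc N)
  define w where "w = (\<lambda>N k. triple_coeff q N k * q powi (k\<^sup>2))"
  define a where "a = q ^ (2*N+1)"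
  define c where "c = (1 - (q\<^sup>2) powi (2 * int N + 1)) * (1 - (q\<^sup>2) powi (2 * int N + 2))"
  define S where "S = of_real (inv_qpoch (q\<^sup>2) (2 * int N)) *
           (\<Prod>n<N. (1 + z * of_real (q ^ (2*n+1))) * (1 + of_real (q ^ (2*n+1)) / z))"
  have p: "0 < q\<^sup>2" "q\<^sup>2 < 1" using q by (auto simp: power_less_one_iff)
  have "(q\<^sup>2) powi m < 1" if "m > 0" for m
    using power_int_strict_decreasing[of 0 m "q\<^sup>2"] that p by simp
  then have c: "c \<noteq> 0" by (auto simp: c_def less_le)
  have S: "((\<lambda>k. of_real (w N k) * z powi k) has_sum S) UNIV"
    using Suc by (simp add: w_def S_def)
  have S1: "((\<lambda>k. of_real (w N (k-1)) * z powi k) has_sum z * S) UNIV"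
  proof -
    have "((\<lambda>k. z * (of_real (w N k) * z powi k)) has_sum z * S) UNIV"
      by (rule has_sum_cmult_right[OF S])
    then show ?thesis
      by (rule has_sum_reindex_bij_witness[THEN iffD1, rotated -1, of _ _ _ "\<lambda>k. k - 1" "\<lambda>k. k + 1"])
        (use z in \<open>auto simp: power_int_add\<close>)
  qed
  have S2: "((\<lambda>k. of_real (w N (k+1)) * z powi k) has_sum (1 / z) * S) UNIV"
  proof -
    have "((\<lambda>k. (1 / z) * (of_real (w N k) * z powi k)) has_sum (1 / z) * S) UNIV"
      by (rule has_sum_cmult_right[OF S])
    then show ?thesis
      by (rule has_sum_reindex_bij_witness[THEN iffD1, rotated -1, of _ _ _ "\<lambda>k. k + 1" "\<lambda>k. k - 1"])
        (use z in \<open>auto simp: power_int_diff\<close>)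
  qed
  have "((\<lambda>k. (1 + of_real a * of_real a) * (of_real (w N k) * z powi k) +
         (of_real a * (of_real (w N (k-1)) * z powi k) + of_real a * (of_real (w N (k+1)) * z powi k)))
         has_sum (1 + of_real a * of_real a) * S + (of_real a * (z * S) + of_real a * ((1 / z) * S))) UNIV"
    by (intro has_sum_add has_sum_cmult_right S S1 S2)
  also have "(1 + of_real a * of_real a) * S + (of_real a * (z * S) + of_real a * ((1 / z) * S)) =
             S * ((1 + z * of_real a) * (1 + of_real a / z))"
    using z by (simp add: field_simps)
  also have "(\<lambda>k. (1 + of_real a * of_real a) * (of_real (w N k) * z powi k) +
         (of_real a * (of_real (w N (k-1)) * z powi k) + of_real a * (of_real (w N (k+1)) * z powi k))) =
         (\<lambda>k. of_real c * (of_real (w (Suc N) k) * z powi k))"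
  proof
    fix k
    have "c * w (Suc N) k = (1 + a * a) * w N k + a * (w N (k-1) + w N (k+1))"
      using triple_coeff_Suc[OF q, of N k] by (simp only: a_def c_def w_def)
    then have "complex_of_real c * of_real (w (Suc N) k) =
        (1 + of_real a * of_real a) * of_real (w N k) + of_real a * (of_real (w N (k-1)) + of_real (w N (k+1)))"
      by (metis (no_types, opaque_lifting) of_real_1 of_real_add of_real_mult)
    from arg_cong[OF this, of "\<lambda>x. x * z powi k"]
    show "(1 + of_real a * of_real a) * (of_real (w N k) * z powi k) +
         (of_real a * (of_real (w N (k-1)) * z powi k) + of_real a * (of_real (w N (k+1)) * z powi k)) =
         of_real c * (of_real (w (Suc N) k) * z powi k)"
      by (simp add: algebra_simps)
  qed
  finally have *: "((\<lambda>k. of_real (w (Suc N) k) * z powi k) has_sum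
      S * ((1 + z * of_real a) * (1 + of_real a / z)) / of_real c) UNIV"
    using c by (simp add: has_sum_cmult_right_iff)
  have "inv_qpoch (q\<^sup>2) (2 * int N) = c * inv_qpoch (q\<^sup>2) (2 * int (Suc N))"
  proof -
    have "inv_qpoch (q\<^sup>2) (2 * int N) =
          (1 - (q\<^sup>2) powi (2 * int N + 1)) * inv_qpoch (q\<^sup>2) (2 * int N + 1)"
      using inv_qpoch_diff_1[OF p, of "2 * int N + 1"] by simp
    also have "inv_qpoch (q\<^sup>2) (2 * int N + 1) =
          (1 - (q\<^sup>2) powi (2 * int N + 2)) * inv_qpoch (q\<^sup>2) (2 * int N + 2)"
      using inv_qpoch_diff_1[OF p, of "2 * int N + 2"] by (simp only: add_diff_eq[symmetric]) simp
    finally show ?thesis by (simp add: c_def algebra_simps)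
  qed
  then have "S * ((1 + z * of_real a) * (1 + of_real a / z)) / of_real c =
     of_real (inv_qpoch (q\<^sup>2) (2 * int (Suc N))) *
           (\<Prod>n<Suc N. (1 + z * of_real (q ^ (2*n+1))) * (1 + of_real (q ^ (2*n+1)) / z))"
    using c by (simp add: S_def a_def)
  with * show ?case by (simp only: w_def)
qed

section \<open>The theta function as a limit of finite products\<close>

definition theta :: "real \<Rightarrow> complex \<Rightarrow> complex" where
  "theta q z = (\<Sum>\<^sub>\<infinity>k::int. of_real (q powi (k\<^sup>2)) * z powi k)"

lemma summable_on_powi_square:
  fixes q :: real
  assumes q: "0 < q" "q < 1"
  shows "(\<lambda>k::int. q powi (k\<^sup>2)) summable_on UNIV"
proof -
  have geo: "(\<lambda>n::nat. q ^ n) summable_on UNIV"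
    using q by (intro summable_nonneg_imp_summable_on summable_geometric) auto
  have le: "q powi (k\<^sup>2) \<le> q ^ nat \<bar>k\<bar>" for k
  proof -
    have "\<bar>k\<bar> * 1 \<le> \<bar>k\<bar> * \<bar>k\<bar>" if "k \<noteq> 0"
      using that by (intro mult_left_mono) auto
    then have "\<bar>k\<bar> \<le> k\<^sup>2" by (cases "k = 0") (auto simp: power2_eq_square)
    then have "q powi (k\<^sup>2) \<le> q powi \<bar>k\<bar>"
      using q by (intro power_int_decreasing) auto
    then show ?thesis by (simp add: power_int_nonneg_exp)
  qed
  have "(\<lambda>k. q ^ nat \<bar>k\<bar>) summable_on range int"
    by (subst summable_on_reindex) (auto simp: o_def geo)
  moreover have "(\<lambda>k. q ^ nat \<bar>k\<bar>) summable_on range (\<lambda>n. - int n)"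
    by (subst summable_on_reindex) (auto simp: o_def geo inj_on_def)
  ultimately have "(\<lambda>k. q ^ nat \<bar>k\<bar>) summable_on (range int \<union> range (\<lambda>n. - int n))"
    by (rule summable_on_union)
  moreover have "range int \<union> range (\<lambda>n. - int n) = UNIV"
  proof -
    have "k \<in> range int \<union> range (\<lambda>n. - int n)" for k :: int
      by (cases k rule: int_cases2) auto
    then show ?thesis by blast
  qed
  ultimately have "(\<lambda>k. q ^ nat \<bar>k\<bar>) summable_on UNIV" by simp
  then show ?thesis
    by (rule summable_on_comparison_test) (use le q in auto)
qed

lemma theta_1:
  assumes "0 < q" "q < 1"
  shows "theta q 1 = of_real (\<Sum>\<^sub>\<infinity>k::int. q powi (k\<^sup>2))"
  unfolding theta_def power_int_1_left mult_1_right
  by (intro infsumI has_sum_of_real has_sum_infsum summable_on_powi_square assms)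

text \<open>
  All terms are positive, and the term at 0 equals 1.
\<close>

lemma theta_1_nonzero:
  assumes q: "0 < q" "q < 1"
  shows "theta q 1 \<noteq> 0"
proof -
  have "(\<Sum>k\<in>{0::int}. q powi (k\<^sup>2)) \<le> (\<Sum>\<^sub>\<infinity>k. q powi (k\<^sup>2))"
    using q by (intro finite_sum_le_infsum summable_on_powi_square) auto
  then show ?thesis using q by (simp add: theta_1)
qed

text \<open>
  Tannery's theorem for unordered sums: the Weierstrass M-test makes the finite partial sums
  converge uniformly in \<open>n\<close>, so the two limits can be interchanged.
\<close>

lemma tendsto_infsum_dominated:
  fixes f :: "'a \<Rightarrow> nat \<Rightarrow> 'b :: banach"
  assumes lim: "\<And>k. f k \<longlonglongrightarrow> g k"
    and bound: "\<And>k n. norm (f k n) \<le> M k"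
    and M: "M summable_on UNIV"
  shows "(\<lambda>n. \<Sum>\<^sub>\<infinity>k. f k n) \<longlonglongrightarrow> (\<Sum>\<^sub>\<infinity>k. g k)"
proof -
  have unif: "uniform_limit UNIV (\<lambda>X n. \<Sum>k\<in>X. f k n) (\<lambda>n. \<Sum>\<^sub>\<infinity>k. f k n) (finite_subsets_at_top UNIV)"
    by (rule Weierstrass_m_test_general[where f = f and M = M]) (simp_all add: bound M)
  have partial: "\<forall>\<^sub>F X in finite_subsets_at_top UNIV. (\<lambda>n. \<Sum>k\<in>X. f k n) \<longlonglongrightarrow> (\<Sum>k\<in>X. g k)"
    by (rule always_eventually) (rule allI, rule tendsto_sum, rule lim)
  have "norm (g k) \<le> M k" for k
    by (rule Lim_norm_ubound[OF trivial_limit_sequentially lim[of k]]) (simp add: bound)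
  then have "(\<lambda>k. norm (g k)) summable_on UNIV"
    by (intro Infinite_Sum.abs_summable_on_comparison_test'[where f = g and g = M] M)
  then have "(g has_sum (\<Sum>\<^sub>\<infinity>k. g k)) UNIV"
    by (rule has_sum_infsum[OF abs_summable_summable])
  then have "(sum g \<longlongrightarrow> (\<Sum>\<^sub>\<infinity>k. g k)) (finite_subsets_at_top UNIV)"
    by (simp add: has_sum_def)
  then show ?thesis
    using swap_uniform_limit'[where f = "\<lambda>X n. \<Sum>k\<in>X. f k n" and g = "sum g" and G = sequentially
      and F = "finite_subsets_at_top UNIV" and S = UNIV and h = "\<lambda>n. \<Sum>\<^sub>\<infinity>k. f k n"] partial unif
    by simp
qed

text \<open>
  Both \<open>inv_qpoch (q\<^sup>2) (N + k)\<close> and \<open>inv_qpoch (q\<^sup>2) (N - k)\<close> tend to the same limit \<open>L\<close> for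
  every fixed \<open>k\<close>, so the coefficients of the finite triple product tend to \<open>L\<^sup>2 q ^ k\<^sup>2\<close>; as
  they are bounded, \<open>q ^ k\<^sup>2\<close> times a constant dominates them. The
  constant \<open>C = L\<^sup>2\<close> cancels in quotients of theta values.
\<close>

lemma theta_tendsto:
  assumes q: "0 < q" "q < 1"
  shows "\<exists>C > 0. \<forall>z. norm z = 1 \<longrightarrow>
      (\<lambda>N. of_real (inv_qpoch (q\<^sup>2) (2 * int N)) *
           (\<Prod>n<N. (1 + z * of_real (q ^ (2*n+1))) * (1 + of_real (q ^ (2*n+1)) / z)))
      \<longlonglongrightarrow> of_real C * theta q z"
proof -
  have p: "0 < q\<^sup>2" "q\<^sup>2 < 1" using q by (auto simp: power_less_one_iff)
  obtain L where L: "L > 0" "(\<lambda>n. inv_qpoch (q\<^sup>2) (int n)) \<longlonglongrightarrow> L"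
    using inv_qpoch_tendsto[OF p] .
  obtain K where K: "K > 0" "\<And>n. norm (inv_qpoch (q\<^sup>2) (int n)) \<le> K"
    using convergent_imp_Bseq[OF convergentI[OF L(2)]] unfolding Bseq_def by blast
  have bound: "\<bar>inv_qpoch (q\<^sup>2) m\<bar> \<le> K" for m
    using K(2)[of "nat m"] K(1) by (cases "m < 0") auto
  have coeff_bound: "\<bar>triple_coeff q N k\<bar> \<le> K * K" for N k
    unfolding triple_coeff_def abs_mult using K(1) by (intro mult_mono bound) auto
  have shift: "(\<lambda>N. inv_qpoch (q\<^sup>2) (int N + k)) \<longlonglongrightarrow> L" for k
  proof (cases k rule: int_cases2)
    case (nonneg m)
    then show ?thesis using LIMSEQ_ignore_initial_segment[OF L(2), of m] by simp
  next
    case (nonpos m)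
    have "(\<lambda>N. inv_qpoch (q\<^sup>2) (int (N + m) + k)) \<longlonglongrightarrow> L"
      using L(2) by (simp add: nonpos)
    then show ?thesis by (rule LIMSEQ_offset)
  qed
  have coeff_lim: "(\<lambda>N. triple_coeff q N k) \<longlonglongrightarrow> L * L" for k
    unfolding triple_coeff_def using tendsto_mult[OF shift[of k] shift[of "-k"]] by simp
  show ?thesis
  proof (intro exI[of _ "L * L"] conjI allI impI)
    show "L * L > 0" using L(1) by simp
  next
    fix z :: complex assume z: "norm z = 1"
    then have z0: "z \<noteq> 0" by auto
    have sum: "(\<Sum>\<^sub>\<infinity>k. of_real (triple_coeff q N k * q powi (k\<^sup>2)) * z powi k) =
        of_real (inv_qpoch (q\<^sup>2) (2 * int N)) *
          (\<Prod>n<N. (1 + z * of_real (q ^ (2*n+1))) * (1 + of_real (q ^ (2*n+1)) / z))" for N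
      by (rule infsumI[OF finite_triple_product[OF q z0]])
    have limit: "(\<Sum>\<^sub>\<infinity>k. of_real (L * L * q powi (k\<^sup>2)) * z powi k) = of_real (L * L) * theta q z"
      unfolding theta_def infsum_cmult_right'[symmetric] by (simp only: of_real_mult mult.assoc)
    have "(\<lambda>N. \<Sum>\<^sub>\<infinity>k. of_real (triple_coeff q N k * q powi (k\<^sup>2)) * z powi k) \<longlonglongrightarrow>
          (\<Sum>\<^sub>\<infinity>k. of_real (L * L * q powi (k\<^sup>2)) * z powi k)"
    proof (rule tendsto_infsum_dominated[where M = "\<lambda>k. K * K * q powi (k\<^sup>2)"])
      show "(\<lambda>N. of_real (triple_coeff q N k * q powi (k\<^sup>2)) * z powi k) \<longlonglongrightarrow>
            of_real (L * L * q powi (k\<^sup>2)) * z powi k" for k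
        by (rule tendsto_mult[OF tendsto_of_real[OF tendsto_mult[OF coeff_lim tendsto_const]] tendsto_const])
      show "norm (of_real (triple_coeff q N k * q powi (k\<^sup>2)) * z powi k) \<le> K * K * q powi (k\<^sup>2)" for k N
        using q z mult_right_mono[OF coeff_bound[of N k], of "q powi (k\<^sup>2)"]
        by (simp add: norm_mult norm_power_int abs_mult)
      show "(\<lambda>k::int. K * K * q powi (k\<^sup>2)) summable_on UNIV"
        by (rule summable_on_cmult_right[OF summable_on_powi_square[OF q]])
    qed
    then show "(\<lambda>N. of_real (inv_qpoch (q\<^sup>2) (2 * int N)) *
           (\<Prod>n<N. (1 + z * of_real (q ^ (2*n+1))) * (1 + of_real (q ^ (2*n+1)) / z)))
      \<longlonglongrightarrow> of_real (L * L) * theta q z"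
      unfolding sum limit .
  qed
qed

text \<open>
  On the unit circle the factors \<open>1 + z s\<close> and \<open>1 + s / z\<close> are complex conjugates, so each
  quotient of factors is the real number
  \<open>(1 + 2 s cos \<phi> + s\<^sup>2) / (1 + s)\<^sup>2\<close>.
\<close>

lemma theta_quotient_product:
  assumes q: "0 < q" "q < 1"
  shows "(\<lambda>N. complex_of_real (\<Prod>n<N. 1 - 2 * q ^ (2*n+1) * (1 - cos \<phi>) / (1 + q ^ (2*n+1))\<^sup>2))
           \<longlonglongrightarrow> theta q (cis \<phi>) / theta q 1"
proof -
  have p: "0 < q\<^sup>2" "q\<^sup>2 < 1" using q by (auto simp: power_less_one_iff)
  define P where "P = (\<lambda>N z. of_real (inv_qpoch (q\<^sup>2) (2 * int N)) *
           (\<Prod>n<N. (1 + z * of_real (q ^ (2*n+1))) * (1 + complex_of_real (q ^ (2*n+1)) / z)))"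
  from theta_tendsto[OF q] obtain C where C: "C > 0" "\<forall>z. norm z = 1 \<longrightarrow>
      (\<lambda>N. of_real (inv_qpoch (q\<^sup>2) (2 * int N)) *
           (\<Prod>n<N. (1 + z * of_real (q ^ (2*n+1))) * (1 + of_real (q ^ (2*n+1)) / z)))
      \<longlonglongrightarrow> of_real C * theta q z"
    by (elim exE conjE)
  have lim: "(\<lambda>N. P N z) \<longlonglongrightarrow> of_real C * theta q z" if "norm z = 1" for z
    unfolding P_def by (rule C(2)[rule_format, OF that])
  have quot: "P N (cis \<phi>) / P N 1 =
    complex_of_real (\<Prod>n<N. 1 - 2 * q ^ (2*n+1) * (1 - cos \<phi>) / (1 + q ^ (2*n+1))\<^sup>2)" for N
  proof -
    have nz: "complex_of_real (inv_qpoch (q\<^sup>2) (2 * int N)) \<noteq> 0"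
    proof -
      have "1 - (q\<^sup>2) ^ Suc j > 0" for j
        using p by (simp add: power_less_one_iff del: power_Suc)
      then have "1 - (q\<^sup>2) ^ Suc j \<noteq> 0" for j by (metis less_irrefl)
      then have "inv_qpoch (q\<^sup>2) (2 * int N) \<noteq> 0" by (simp add: inv_qpoch_def del: power_Suc)
      then show ?thesis unfolding of_real_eq_0_iff .
    qed
    have factor: "(1 + cis \<phi> * of_real s) * (1 + of_real s / cis \<phi>) / ((1 + 1 * of_real s) * (1 + of_real s / 1)) =
          complex_of_real (1 - 2 * s * (1 - cos \<phi>) / (1 + s)\<^sup>2)" if "s > 0" for s
    proof -
      have "(1 + cis \<phi> * of_real s) * (1 + of_real s / cis \<phi>) =
            1 + of_real s * (cis \<phi> + cis (- \<phi>)) + of_real (s\<^sup>2)"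
        by (simp add: field_simps power2_eq_square flip: cis_inverse)
      also have "cis \<phi> + cis (- \<phi>) = of_real (2 * cos \<phi>)"
        by (simp add: complex_eq_iff)
      finally have num: "(1 + cis \<phi> * of_real s) * (1 + of_real s / cis \<phi>) = of_real (1 + 2 * s * cos \<phi> + s\<^sup>2)"
        by simp
      have den: "(1 + 1 * of_real s) * (1 + complex_of_real s / 1) = of_real ((1 + s)\<^sup>2)"
        by (simp add: power2_eq_square)
      have "1 + 2 * s * cos \<phi> + s\<^sup>2 = (1 + s)\<^sup>2 - 2 * s * (1 - cos \<phi>)"
        by (simp add: power2_eq_square algebra_simps)
      then have "(1 + 2 * s * cos \<phi> + s\<^sup>2) / (1 + s)\<^sup>2 = 1 - 2 * s * (1 - cos \<phi>) / (1 + s)\<^sup>2"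
        using that by (simp add: diff_divide_distrib)
      then show ?thesis unfolding num den of_real_divide[symmetric] by (rule arg_cong)
    qed
    have "P N (cis \<phi>) / P N 1 =
        (\<Prod>n<N. (1 + cis \<phi> * of_real (q ^ (2*n+1))) * (1 + of_real (q ^ (2*n+1)) / cis \<phi>) /
                ((1 + 1 * of_real (q ^ (2*n+1))) * (1 + of_real (q ^ (2*n+1)) / 1)))"
      unfolding P_def prod_dividef by (rule mult_divide_mult_cancel_left[OF nz])
    also have "\<dots> = (\<Prod>n<N. complex_of_real (1 - 2 * q ^ (2*n+1) * (1 - cos \<phi>) / (1 + q ^ (2*n+1))\<^sup>2))"
      by (rule prod.cong[OF refl], rule factor, rule zero_less_power, rule q)
    finally show ?thesis by (simp only: of_real_prod)
  qed
  have "(\<lambda>N. P N (cis \<phi>) / P N 1) \<longlonglongrightarrow> of_real C * theta q (cis \<phi>) / (of_real C * theta q 1)"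
    by (rule tendsto_divide[OF lim lim]) (use C(1) theta_1_nonzero[OF q] in auto)
  moreover have "of_real C * theta q (cis \<phi>) / (of_real C * theta q 1) = theta q (cis \<phi>) / theta q 1"
    using C(1) by simp
  ultimately show ?thesis by (simp only: quot)
qed

section \<open>The one-dimensional bound\<close>

text \<open>
  By concavity, sine lies above its chord on \<open>[0, pi / 2]\<close>.
\<close>

lemma sin_pi_ge_double:
  fixes x :: real
  assumes "0 \<le> x" "x \<le> 1/2"
  shows "2 * x \<le> sin (pi * x)"
proof -
  have "concave_on {0..pi/2} sin"
    by (rule f''_le0_imp_concave[where f' = cos and f'' = "\<lambda>x. - sin x"])
      (auto intro!: derivative_eq_intros sin_ge_zero)
  from concave_onD_Icc'[OF this, of "pi * x"] assms show ?thesis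
    by (simp add: field_simps)
qed

lemma one_minus_cos_ge:
  fixes x :: real
  assumes "\<bar>x\<bar> \<le> 1/2"
  shows "8 * x\<^sup>2 \<le> 1 - cos (2 * pi * x)"
proof -
  have "2 * \<bar>x\<bar> \<le> sin (pi * \<bar>x\<bar>)" using assms by (intro sin_pi_ge_double) auto
  then have "(2 * \<bar>x\<bar>)\<^sup>2 \<le> (sin (pi * \<bar>x\<bar>))\<^sup>2" by (intro power_mono) auto
  also have "(sin (pi * \<bar>x\<bar>))\<^sup>2 = (sin (pi * x))\<^sup>2" by (auto simp: abs_if)
  also have "2 * (sin (pi * x))\<^sup>2 = 1 - cos (2 * pi * x)"
    using cos_double_sin[of "pi * x"] by (simp add: mult_ac)
  finally show ?thesis by (simp add: power2_eq_square)
qed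

text \<open>
  Every factor of the product lies in \<open>[0, 1]\<close>, so the product may be cut off after any
  number \<open>M\<close> of factors. The cut is made where \<open>2 n + 1\<close> reaches \<open>t / pi\<close>: up to there
  \<open>s = q ^ (2n+1)\<close> is at least \<open>exp (-1) \<ge> 1 / 3\<close>, hence \<open>s / (1 + s)\<^sup>2 \<ge> 3 / 16\<close>, and each
  factor is at most \<open>exp (- 3 x\<^sup>2)\<close>. There are at least \<open>t / (2 pi) - 1 / 2\<close> such factors, and
  \<open>3 (t / (2 pi) - 1 / 2) \<ge> pi t / 10\<close> for \<open>t \<ge> 15\<close> because \<open>pi\<^sup>2 + pi \<le> 15\<close>.
\<close>

lemma theta_quotient_bound:
  fixes t x :: real
  assumes t: "t \<ge> 15" and x: "\<bar>x\<bar> \<le> 1/2"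
  defines "q \<equiv> exp (- pi / t)"
  obtains r where "theta q (cis (2 * pi * x)) / theta q 1 = of_real r" "0 \<le> r" "r \<le> exp (- pi * t * x\<^sup>2 / 10)"
proof -
  have q: "0 < q" "q < 1" using t by (auto simp: q_def)
  define u where "u = 1 - cos (2 * pi * x)"
  have u: "0 \<le> u" "u \<le> 2" "8 * x\<^sup>2 \<le> u"
    using one_minus_cos_ge[OF x] by (auto simp: u_def)
  define f where "f = (\<lambda>n. 1 - 2 * q ^ (2*n+1) * u / (1 + q ^ (2*n+1))\<^sup>2)"
  have f0: "f n \<ge> 0" for n
  proof -
    define s where "s = q ^ (2*n+1)"
    have s: "s > 0" using q by (simp add: s_def)
    have "2 * s * u \<le> 2 * s * 2" using s u by (intro mult_left_mono) auto
    also have "\<dots> \<le> (1 + s)\<^sup>2" using zero_le_power2[of "1 - s"] by (simp add: power2_eq_square algebra_simps)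
    finally have "2 * s * u / (1 + s)\<^sup>2 \<le> 1" using s by simp
    then show ?thesis by (simp only: f_def s_def)
  qed
  have f1: "f n \<le> 1" for n
    using q u by (simp add: f_def)
  define M where "M = nat \<lfloor>(t / pi + 1) / 2\<rfloor>"
  have "real M = of_int \<lfloor>(t / pi + 1) / 2\<rfloor>"
    using t by (simp add: M_def)
  then have Mle: "real M \<le> (t / pi + 1) / 2" and Mge: "real M \<ge> (t / pi + 1) / 2 - 1"
    by linarith+
  have fM: "f n \<le> exp (- 3 * x\<^sup>2)" if n: "n < M" for n
  proof -
    define s where "s = q ^ (2*n+1)"
    have s: "s > 0" "s \<le> 1" using q power_le_one[of q "2*n+1"] by (simp_all only: s_def zero_less_power less_imp_le)
    have "real (n + 1) \<le> real M" using n by (intro of_nat_mono) auto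
    with Mle have "real (2*n+1) \<le> t / pi" by simp
    then have "real (2*n+1) * pi / t \<le> 1" using t by (simp add: field_simps)
    moreover have "s = exp (- (real (2*n+1) * pi / t))"
      by (simp only: s_def q_def exp_of_nat_mult[symmetric]) simp
    ultimately have "exp (-1) \<le> s" by simp
    moreover have "1 / 3 \<le> exp (- 1 :: real)"
      using exp_le by (simp add: exp_minus field_simps)
    ultimately have s3: "1 / 3 \<le> s" by linarith
    (* s / (1 + s)^2 equals 3/16 at s = 1/3 and at s = 3. *)
    have "(3 * s - 1) * (3 - s) \<ge> 0" using s3 s by (intro mult_nonneg_nonneg) auto
    moreover have "(3 * s - 1) * (3 - s) = 16 * s - 3 * (1 + s)\<^sup>2"
      by (simp add: power2_eq_square algebra_simps)
    ultimately have "3 / 16 * (1 + s)\<^sup>2 \<le> s" by simp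
    then have s16: "3 / 16 \<le> s / (1 + s)\<^sup>2" using s by (simp add: field_simps)
    have "3 * x\<^sup>2 = 2 * (3 / 16) * (8 * x\<^sup>2)" by simp
    also have "\<dots> \<le> 2 * (s / (1 + s)\<^sup>2) * u"
      using s16 u s by (intro mult_mono) auto
    finally have "1 - 2 * s * u / (1 + s)\<^sup>2 \<le> 1 + (- 3 * x\<^sup>2)" by simp
    then have "f n \<le> 1 + (- 3 * x\<^sup>2)" by (simp only: f_def s_def)
    also have "\<dots> \<le> exp (- 3 * x\<^sup>2)" by (rule exp_ge_add_one_self)
    finally show ?thesis .
  qed
  have main: "(\<Prod>n<N. f n) \<in> {0..exp (- pi * t * x\<^sup>2 / 10)}" if "N \<ge> M" for N
  proof -
    have "(\<Prod>n<N. f n) = (\<Prod>n<M. f n) * (\<Prod>n\<in>{M..<N}. f n)"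
      using that by (metis prod.atLeastLessThan_concat lessThan_atLeast0 zero_le)
    also have "\<dots> \<le> (\<Prod>n<M. f n) * 1"
      by (intro mult_left_mono prod_le_1 prod_nonneg) (auto simp: f0 f1)
    also have "\<dots> \<le> (\<Prod>n<M. exp (- 3 * x\<^sup>2))"
      unfolding mult_1_right by (rule prod_mono) (use fM f0 in blast)
    also have "\<dots> = exp (- 3 * x\<^sup>2 * real M)" by (simp add: exp_of_nat_mult[symmetric] mult_ac)
    also have "\<dots> \<le> exp (- pi * t * x\<^sup>2 / 10)"
    proof -
      have "pi * t / 10 \<le> 3 * ((t / pi + 1) / 2 - 1)"
      proof -
        have "pi < 16 / 5" using pi_approx by simp
        then have "pi * pi \<le> 16 / 5 * (16 / 5)" by (intro mult_mono) auto
        then have "pi * pi + pi \<le> 15" using \<open>pi < 16 / 5\<close> by simp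
        then have "t * (pi * pi + pi) \<le> t * 15" using t by (intro mult_left_mono) auto
        moreover have "15 * pi \<le> t * pi" using t by (intro mult_right_mono) auto
        moreover have "pi * t * pi = t * (pi * pi + pi) - t * pi" by (simp add: algebra_simps)
        ultimately have "pi * t * pi \<le> 15 * t - 15 * pi" by linarith
        then show ?thesis by (simp add: field_simps)
      qed
      also have "\<dots> \<le> 3 * real M" using Mge by simp
      finally have "x\<^sup>2 * (pi * t / 10) \<le> x\<^sup>2 * (3 * real M)" by (intro mult_left_mono) auto
      then show ?thesis by (simp add: mult_ac)
    qed
    finally show ?thesis by (auto intro!: prod_nonneg f0)
  qed
  have lim: "(\<lambda>N. complex_of_real (\<Prod>n<N. f n)) \<longlonglongrightarrow> theta q (cis (2 * pi * x)) / theta q 1"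
    using theta_quotient_product[OF q, of "2 * pi * x"] by (simp only: f_def u_def)
  (* A closed set of complex numbers, so reality and both bounds pass to the limit at once. *)
  have "theta q (cis (2 * pi * x)) / theta q 1 \<in> of_real ` {0..exp (- pi * t * x\<^sup>2 / 10)}"
  proof (rule Lim_in_closed_set[OF _ _ _ lim])
    show "closed (complex_of_real ` {0..exp (- pi * t * x\<^sup>2 / 10)})"
      by (intro compact_imp_closed compact_continuous_image continuous_intros) auto
    show "\<forall>\<^sub>F N in sequentially. complex_of_real (\<Prod>n<N. f n) \<in> of_real ` {0..exp (- pi * t * x\<^sup>2 / 10)}"
      using eventually_ge_at_top[of M] by eventually_elim (intro imageI main)
  qed auto
  then show thesis using that by auto
qed

section \<open>Reduction to one dimension\<close>

text \<open>
  If \<open>f\<close> is not summable on \<open>A\<close>, both sides are 0 by convention.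
\<close>

lemma infsum_complex_of_real: "(\<Sum>\<^sub>\<infinity>x\<in>A. complex_of_real (f x)) = of_real (\<Sum>\<^sub>\<infinity>x\<in>A. f x)"
proof (cases "f summable_on A")
  case True
  then show ?thesis by (intro infsumI has_sum_of_real has_sum_infsum)
next
  case False
  then have "\<not> (\<lambda>x. complex_of_real (f x)) summable_on A"
    using summable_on_Re by fastforce
  with False show ?thesis by (simp add: infsum_not_exists)
qed

lemma infsum_vec_prod:
  fixes f :: "'n::finite \<Rightarrow> int \<Rightarrow> complex"
  assumes "\<And>i. (\<lambda>k. norm (f i k)) summable_on UNIV"
  shows "(\<Sum>\<^sub>\<infinity>n::int ^ 'n. \<Prod>i\<in>UNIV. f i (n $ i)) = (\<Prod>i\<in>UNIV. \<Sum>\<^sub>\<infinity>k. f i k)"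
proof -
  have bij: "bij_betw (vec_nth :: int ^ 'n \<Rightarrow> _) UNIV (PiE UNIV (\<lambda>_. UNIV))"
    by (rule bij_betwI[of _ _ _ vec_lambda]) auto
  have "(\<Sum>\<^sub>\<infinity>n::int ^ 'n. \<Prod>i\<in>UNIV. f i (n $ i)) =
        (\<Sum>\<^sub>\<infinity>g\<in>PiE UNIV (\<lambda>_. UNIV). \<Prod>i\<in>UNIV. f i (g i))"
    by (rule infsum_reindex_bij_betw[OF bij])
  also have "\<dots> = (\<Prod>i\<in>UNIV. \<Sum>\<^sub>\<infinity>k. f i k)"
    using assms by (intro infsum_prod_PiE_abs) auto
  finally show ?thesis .
qed

lemma norm_real_vec_sq: "(norm (real_vec n))\<^sup>2 = real_of_int (\<Sum>i\<in>UNIV. (n $ i)\<^sup>2)"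
  by (simp add: real_vec_def norm_eq_sqrt_inner inner_vec_def sum_nonneg power2_eq_square)

lemma gaussian_weight_prod:
  assumes "t > 0"
  shows "exp (- pi * (norm (real_vec n))\<^sup>2 / t) = (\<Prod>i\<in>UNIV. exp (- pi / t) powi ((n $ i)\<^sup>2))"
proof -
  have "exp (- pi / t) powi m = exp (- pi * of_int m / t)" for m
    using exp_power_int[of "- pi / t" m] by (simp add: mult_ac)
  moreover have "- pi * (norm (real_vec n))\<^sup>2 / t = (\<Sum>i\<in>UNIV. - pi * of_int ((n $ i)\<^sup>2) / t)"
    unfolding norm_real_vec_sq by (simp only: of_int_sum sum_distrib_left sum_divide_distrib)
  ultimately show ?thesis by (simp only: exp_sum finite)
qed

text \<open>
  Both the Gaussian weight and the character \<open>n \<mapsto> exp (\<i> n \<bullet> \<phi>)\<close> are products over the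
  coordinates, so the lattice sum factors. The phases \<open>\<phi> = 0\<close> give the normalizing
  denominator of the discrete Gaussian, general phases the numerator of its Fourier transform.
\<close>

lemma infsum_gaussian_phase:
  fixes \<phi> :: "'n::finite \<Rightarrow> real"
  assumes "t > 0"
  shows "(\<Sum>\<^sub>\<infinity>n::int ^ 'n. of_real (exp (- pi * (norm (real_vec n))\<^sup>2 / t)) * (\<Prod>i\<in>UNIV. cis (\<phi> i) powi (n $ i))) =
         (\<Prod>i\<in>UNIV. theta (exp (- pi / t)) (cis (\<phi> i)))"
proof -
  define q where "q = exp (- pi / t)"
  have q: "0 < q" "q < 1" using assms by (auto simp: q_def)
  have "(\<Sum>\<^sub>\<infinity>n::int ^ 'n. of_real (exp (- pi * (norm (real_vec n))\<^sup>2 / t)) * (\<Prod>i\<in>UNIV. cis (\<phi> i) powi (n $ i))) =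
        (\<Sum>\<^sub>\<infinity>n::int ^ 'n. \<Prod>i\<in>UNIV. of_real (q powi ((n $ i)\<^sup>2)) * cis (\<phi> i) powi (n $ i))"
    by (simp only: gaussian_weight_prod[OF assms] q_def of_real_prod prod.distrib)
  also have "\<dots> = (\<Prod>i\<in>UNIV. \<Sum>\<^sub>\<infinity>k. of_real (q powi (k\<^sup>2)) * cis (\<phi> i) powi k)"
    using summable_on_powi_square[OF q] q
    by (intro infsum_vec_prod) (simp add: norm_mult norm_power_int)
  finally show ?thesis by (simp add: theta_def q_def)
qed

lemma fourier_discrete_gaussian:
  fixes \<xi> :: "real ^ 'n"
  assumes t: "t > 0"
  defines "q \<equiv> exp (- pi / t)"
  shows "fourier_lattice (\<lambda>n. complex_of_real (discrete_gaussian t n)) \<xi> =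
         (\<Prod>i\<in>UNIV. theta q (cis (2 * pi * \<xi> $ i)) / theta q 1)"
proof -
  define Z where "Z = (\<Sum>\<^sub>\<infinity>k::int ^ 'n. exp (- pi * (norm (real_vec k))\<^sup>2 / t))"
  have Z: "complex_of_real Z = (\<Prod>i\<in>(UNIV :: 'n set). theta q 1)"
    using infsum_gaussian_phase[OF t, of "\<lambda>_::'n. 0"]
    by (simp add: Z_def q_def infsum_complex_of_real)
  have phase: "exp (2 * of_real pi * \<i> * of_real (real_vec n \<bullet> \<xi>)) =
               (\<Prod>i\<in>UNIV. cis (2 * pi * \<xi> $ i) powi (n $ i))" for n
  proof -
    have "2 * of_real pi * \<i> * of_real (real_vec n \<bullet> \<xi>) =
          (\<Sum>i\<in>UNIV. \<i> * of_real (of_int (n $ i) * (2 * pi * \<xi> $ i)))"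
      by (simp add: real_vec_def inner_vec_def sum_distrib_left mult_ac)
    then show ?thesis by (simp only: exp_sum finite cis_power_int) (simp only: cis_conv_exp)
  qed
  have "fourier_lattice (\<lambda>n. complex_of_real (discrete_gaussian t n)) \<xi> =
    (\<Sum>\<^sub>\<infinity>n. (1 / of_real Z) * (of_real (exp (- pi * (norm (real_vec n))\<^sup>2 / t)) *
              (\<Prod>i\<in>UNIV. cis (2 * pi * \<xi> $ i) powi (n $ i))))"
    unfolding fourier_lattice_def discrete_gaussian_def phase Z_def[symmetric] by simp
  also have "\<dots> = (1 / of_real Z) * (\<Prod>i\<in>UNIV. theta q (cis (2 * pi * \<xi> $ i)))"
    by (simp only: infsum_cmult_right' infsum_gaussian_phase[OF t] q_def)
  finally show ?thesis by (simp only: Z prod_dividef) simp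
qed

theorem proposition4p2:
  fixes t :: real and \<xi> :: "real ^ 'n"
  assumes "t \<ge> 15"
    and "\<xi> \<in> torus"
  shows "fourier_lattice (\<lambda>n. complex_of_real (discrete_gaussian t n)) \<xi> \<in> \<real> \<and>
         Re (fourier_lattice (\<lambda>n. complex_of_real (discrete_gaussian t n)) \<xi>)
           \<le> exp (- pi * t * (norm \<xi>)\<^sup>2 / 10)"
proof -
  define q where "q = exp (- pi / t)"
  have "\<bar>\<xi> $ i\<bar> \<le> 1/2" for i
  proof -
    have "-1/2 \<le> \<xi> $ i \<and> \<xi> $ i < 1/2" using assms(2) by (simp add: torus_def)
    then show ?thesis by linarith
  qed
  then have "\<exists>r. theta q (cis (2 * pi * \<xi> $ i)) / theta q 1 = of_real r \<and>
             0 \<le> r \<and> r \<le> exp (- pi * t * (\<xi> $ i)\<^sup>2 / 10)" for i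
    using theta_quotient_bound[OF assms(1)] unfolding q_def by metis
  then obtain r where r: "\<And>i. theta q (cis (2 * pi * \<xi> $ i)) / theta q 1 = of_real (r i)"
    "\<And>i. 0 \<le> r i" "\<And>i. r i \<le> exp (- pi * t * (\<xi> $ i)\<^sup>2 / 10)"
    by metis
  have eq: "fourier_lattice (\<lambda>n. complex_of_real (discrete_gaussian t n)) \<xi> = of_real (\<Prod>i\<in>UNIV. r i)"
    using fourier_discrete_gaussian[of t \<xi>] assms(1) by (simp only: r(1) q_def[symmetric] of_real_prod)
  have "(\<Prod>i\<in>UNIV. r i) \<le> (\<Prod>i\<in>UNIV. exp (- pi * t * (\<xi> $ i)\<^sup>2 / 10))"
    by (rule prod_mono) (use r(2,3) in blast)
  also have "\<dots> = exp (\<Sum>i\<in>UNIV. - pi * t * (\<xi> $ i)\<^sup>2 / 10)"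
    by (simp only: exp_sum finite)
  also have "(\<Sum>i\<in>UNIV. - pi * t * (\<xi> $ i)\<^sup>2 / 10) = - pi * t * (norm \<xi>)\<^sup>2 / 10"
    by (simp only: norm_eq_sqrt_inner inner_vec_def inner_real_def real_sqrt_pow2 sum_nonneg
        zero_le_square power2_eq_square[symmetric] zero_le_power2
        sum_distrib_left sum_divide_distrib)
  finally show ?thesis unfolding eq Re_complex_of_real using Reals_of_real by blast
qed

end
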